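(* Let $d,n,m\ge 1$. The parameter space $\Theta(d,n,m)$ of tropical rational functions is stratified into (finitely many) semialgebraic sets, one for each combinatorial type of regular subdivisions of $n+m$ points in $\mathbb R^d$. That is, for each combinatorial type $\tau$, the set of all $\theta\in\Theta(d,n,m)$ for which the regular subdivision of $\operatorname{Newt}(g_\theta\oplus h_\theta)$ induced by $\theta$ has combinatorial type $\tau$ is semialgebraic, and $\Theta(d,n,m)$ is the disjoint union of these sets.
   Context: $\Theta(d,n,m)\cong\mathbb R^{(n+m)(d+1)}$ is the space of parameters $\theta=(a_1,\mathbf s_1,\dots,a_n,\mathbf s_n,b_1,\mathbf t_1,\dots,b_m,\mathbf t_m)$ with $a_i,b_j\in\mathbb R$, $\mathbf s_i,\mathbf t_j\in\mathbb R^d$. Put $g_\theta(\mathbf x)=\max_{i\in[n]}(a_i+\langle\mathbf s_i,\mathbf x\rangle)$, $h_\theta(\mathbf x)=\max_{j\in[m]}(b_j+\langle\mathbf t_j,\mathbf x\rangle)$ and $g_\theta\oplus h_\theta=\max(g_\theta,h_\theta)=\max_{i\in[n+m]}(a_i+\langle\mathbf s_i,\mathbf x\rangle)$, where $a_{n+j}=b_j$, $\mathbf s_{n+j}=\mathbf t_j$. The Newton polytope is $\operatorname{Newt}(g_\theta\oplus h_\theta)=\operatorname{conv}(\mathbf s_1,\dots,\mathbf s_{n+m})\subset\mathbb R^d$. The regular subdivision induced by $\theta$ is obtained by projecting the upper hull of the lifted polytope $\operatorname{conv}((a_1,\mathbf s_1),\dots,(a_{n+m},\mathbf s_{n+m}))\subset\mathbb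 R^{d+1}$ (the faces having an outer normal vector with positive first coordinate) onto the last $d$ coordinates. The combinatorial type of a polyhedral complex is the isomorphism class of its poset of faces ordered by inclusion. A semialgebraic set is a finite union and intersection of solution sets of polynomial inequalities. *)

theory Defs
  imports "HOL-Analysis.Analysis"
begin

section \<open>Tropical polynomials and regular subdivisions\<close>

text \<open>
  A tropical polynomial, or a point configuration with heights, is a family of pairs
  \<open>p i = (a\<^sub>i, s\<^sub>i)\<close>, indexed by a finite type.
\<close>

definition trop_eval :: "('i::finite \<Rightarrow> real \<times> 'a::euclidean_space) \<Rightarrow> 'a \<Rightarrow> real" where
  "trop_eval p x = (MAX i. fst (p i) + snd (p i) \<bullet> x)"

definition newton_polytope :: "('i::finite \<Rightarrow> real \<times> 'a::euclidean_space) \<Rightarrow> 'a set" where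
  "newton_polytope p = convex hull (range (\<lambda>i. snd (p i)))"

definition lifted_polytope :: "('i::finite \<Rightarrow> real \<times> 'a::euclidean_space) \<Rightarrow> (real \<times> 'a) set" where
  "lifted_polytope p = convex hull (range p)"

text \<open>
  The face with outer normal vector \<open>v\<close>, i.e. the set of maximisers of \<open>v\<close>. It is nonempty when
  \<open>P\<close> is compact and nonempty, so the empty face is never a cell below. Adjoining it everywhere
  as a least element would not change which face posets are isomorphic.
\<close>

definition face_in_direction :: "'b::real_inner set \<Rightarrow> 'b \<Rightarrow> 'b set" where
  "face_in_direction P v = {x \<in> P. \<forall>y\<in>P. v \<bullet> y \<le> v \<bullet> x}"

definition upper_faces :: "('i::finite \<Rightarrow> real \<times> 'a::euclidean_space) \<Rightarrow> (real \<times> 'a) set set" where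
  "upper_faces p = {face_in_direction (lifted_polytope p) (c, u) | c u. 0 < c}"

definition regular_subdivision :: "('i::finite \<Rightarrow> real \<times> 'a::euclidean_space) \<Rightarrow> 'a set set" where
  "regular_subdivision p = (\<lambda>F. snd ` F) ` upper_faces p"

lemma face_in_direction_face_of:
  assumes "convex P"
  shows "face_in_direction P v face_of P"
proof (cases "face_in_direction P v = {}")
  case False
  then obtain x where x: "x \<in> P" "\<And>y. y \<in> P \<Longrightarrow> v \<bullet> y \<le> v \<bullet> x"
    by (auto simp: face_in_direction_def)
  have "face_in_direction P v = P \<inter> {y. v \<bullet> y = v \<bullet> x}"
    unfolding face_in_direction_def
  proof (intro set_eqI iffI; clarsimp)
    fix z assume "z \<in> P" "\<forall>y\<in>P. v \<bullet> y \<le> v \<bullet> z"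
    then show "v \<bullet> z = v \<bullet> x" using x(1) x(2)[of z] by (intro antisym) auto
  next
    fix y assume "y \<in> P"
    then show "v \<bullet> y \<le> v \<bullet> x" by (rule x(2))
  qed
  then show ?thesis
    using face_of_Int_supporting_hyperplane_le[OF assms x(2)] by simp
qed simp

lemma face_in_direction_nonempty:
  assumes "compact P" "P \<noteq> {}"
  shows "face_in_direction P v \<noteq> {}"
proof -
  have "continuous_on P (\<lambda>x. v \<bullet> x)" by (intro continuous_intros)
  from continuous_attains_sup[OF assms this] show ?thesis
    by (auto simp: face_in_direction_def)
qed

lemma snd_lifted_polytope: "snd ` lifted_polytope p = newton_polytope p"
  unfolding lifted_polytope_def newton_polytope_def
  by (simp add: convex_hull_linear_image[OF linear_snd] image_image)

lemma regular_subdivision_subset_newton_polytope: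
  "C \<in> regular_subdivision p \<Longrightarrow> C \<subseteq> newton_polytope p"
  unfolding snd_lifted_polytope[symmetric]
  by (auto simp: regular_subdivision_def upper_faces_def face_in_direction_def)


section \<open>Combinatorial types\<close>

definition face_poset_iso :: "'a set set \<Rightarrow> 'b set set \<Rightarrow> bool" where
  "face_poset_iso C D \<longleftrightarrow>
    (\<exists>f. bij_betw f C D \<and> (\<forall>A\<in>C. \<forall>B\<in>C. A \<subseteq> B \<longleftrightarrow> f A \<subseteq> f B))"

text \<open>
  The isomorphism class is formed among all families of subsets of the ambient space, ordered by
  inclusion. Two complexes have the same combinatorial type iff their face posets are isomorphic.
\<close>

definition combinatorial_type :: "'a set set \<Rightarrow> 'a set set set" where
  "combinatorial_type C = {D. face_poset_iso C D}"

lemma face_poset_iso_refl: "face_poset_iso C C"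
  unfolding face_poset_iso_def by (rule exI[of _ id]) auto

lemma face_poset_iso_sym:
  assumes "face_poset_iso C D"
  shows "face_poset_iso D C"
proof -
  obtain f where f: "bij_betw f C D" "\<forall>A\<in>C. \<forall>B\<in>C. A \<subseteq> B \<longleftrightarrow> f A \<subseteq> f B"
    using assms unfolding face_poset_iso_def by (elim exE conjE)
  let ?g = "the_inv_into C f"
  have g: "bij_betw ?g D C" by (rule bij_betw_the_inv_into[OF f(1)])
  have "A \<subseteq> B \<longleftrightarrow> ?g A \<subseteq> ?g B" if "A \<in> D" "B \<in> D" for A B
    using f(2)[rule_format, of "?g A" "?g B"] that bij_betwE[OF g]
      f_the_inv_into_f_bij_betw[OF f(1)] by simp
  with g show ?thesis unfolding face_poset_iso_def by (intro exI[of _ ?g]) simp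
qed

lemma face_poset_iso_trans:
  assumes "face_poset_iso C D" "face_poset_iso D E"
  shows "face_poset_iso C E"
proof -
  obtain f g where f: "bij_betw f C D" "\<forall>A\<in>C. \<forall>B\<in>C. A \<subseteq> B \<longleftrightarrow> f A \<subseteq> f B"
    and g: "bij_betw g D E" "\<forall>A\<in>D. \<forall>B\<in>D. A \<subseteq> B \<longleftrightarrow> g A \<subseteq> g B"
    using assms unfolding face_poset_iso_def by (elim exE conjE)
  have "A \<subseteq> B \<longleftrightarrow> (g \<circ> f) A \<subseteq> (g \<circ> f) B" if "A \<in> C" "B \<in> C" for A B
    using f(2)[rule_format, OF that] g(2)[rule_format, of "f A" "f B"] that bij_betwE[OF f(1)]
    by simp
  then show ?thesis
    unfolding face_poset_iso_def using bij_betw_trans[OF f(1) g(1)]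
    by (intro exI[of _ "g \<circ> f"]) simp
qed

lemma combinatorial_type_eq_iff:
  "combinatorial_type C = combinatorial_type D \<longleftrightarrow> face_poset_iso C D"
proof
  assume "combinatorial_type C = combinatorial_type D"
  then have "D \<in> combinatorial_type C"
    by (simp add: combinatorial_type_def face_poset_iso_refl)
  then show "face_poset_iso C D"
    by (simp add: combinatorial_type_def)
next
  assume "face_poset_iso C D"
  then show "combinatorial_type C = combinatorial_type D"
    unfolding combinatorial_type_def
    by (intro Collect_cong) (meson face_poset_iso_sym face_poset_iso_trans)
qed

text \<open>
  The combinatorial types of regular subdivisions of point configurations indexed by \<open>'i\<close>, that is,
  of \<open>CARD('i)\<close> (not necessarily distinct) points with arbitrary heights.
\<close>

definition subdivision_types :: "'i::finite itself \<Rightarrow> 'a::euclidean_space set set set set" where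
  "subdivision_types _ =
    range (\<lambda>p :: 'i \<Rightarrow> real \<times> 'a. combinatorial_type (regular_subdivision p))"


section \<open>Parameters of tropical rational functions\<close>

text \<open>
  The dimensions \<open>d, n, m \<ge> 1\<close> are the cardinalities of the index types. A parameter consists of the
  family \<open>(a\<^sub>i, s\<^sub>i)\<close> of the numerator and the family \<open>(b\<^sub>j, t\<^sub>j)\<close> of the denominator.
\<close>

type_synonym ('d, 'n, 'm) param = "((real \<times> (real^'d))^'n) \<times> ((real \<times> (real^'d))^'m)"

definition trop_num :: "('d::finite, 'n::finite, 'm::finite) param \<Rightarrow> real^'d \<Rightarrow> real" where
  "trop_num \<theta> = trop_eval (\<lambda>i. fst \<theta> $ i)"

definition trop_den :: "('d::finite, 'n::finite, 'm::finite) param \<Rightarrow> real^'d \<Rightarrow> real" where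
  "trop_den \<theta> = trop_eval (\<lambda>j. snd \<theta> $ j)"

text \<open>The concatenated family, with \<open>a\<^sub>n\<^sub>+\<^sub>j = b\<^sub>j\<close> and \<open>s\<^sub>n\<^sub>+\<^sub>j = t\<^sub>j\<close>.\<close>

definition joint_terms :: "('d::finite, 'n::finite, 'm::finite) param \<Rightarrow> 'n + 'm \<Rightarrow> real \<times> (real^'d)" where
  "joint_terms \<theta> = case_sum (\<lambda>i. fst \<theta> $ i) (\<lambda>j. snd \<theta> $ j)"

lemma trop_eval_joint_terms: "trop_eval (joint_terms \<theta>) x = max (trop_num \<theta> x) (trop_den \<theta> x)"
proof -
  have "range (\<lambda>k. fst (joint_terms \<theta> k) + snd (joint_terms \<theta> k) \<bullet> x) =
      range (\<lambda>i. fst (fst \<theta> $ i) + snd (fst \<theta> $ i) \<bullet> x) \<union>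
      range (\<lambda>j. fst (snd \<theta> $ j) + snd (snd \<theta> $ j) \<bullet> x)"
    by (simp add: UNIV_sum image_Un image_image joint_terms_def)
  then show ?thesis
    by (simp add: trop_num_def trop_den_def trop_eval_def Max_Un)
qed

text \<open>The subdivision of the Newton polytope of the tropical sum of numerator and denominator.\<close>

definition induced_subdivision :: "('d::finite, 'n::finite, 'm::finite) param \<Rightarrow> (real^'d) set set" where
  "induced_subdivision \<theta> = regular_subdivision (joint_terms \<theta>)"

definition stratum ::
  "(real^'d) set set set \<Rightarrow> ('d::finite, 'n::finite, 'm::finite) param set" where
  "stratum \<tau> = {\<theta>. combinatorial_type (induced_subdivision \<theta>) = \<tau>}"


section \<open>Semialgebraic sets\<close>

inductive semialgebraic :: "'a::euclidean_space set \<Rightarrow> bool" where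
  strict: "real_polynomial_function f \<Longrightarrow> semialgebraic {x. 0 < f x}"
| weak: "real_polynomial_function f \<Longrightarrow> semialgebraic {x. 0 \<le> f x}"
| union: "semialgebraic S \<Longrightarrow> semialgebraic T \<Longrightarrow> semialgebraic (S \<union> T)"
| inter: "semialgebraic S \<Longrightarrow> semialgebraic T \<Longrightarrow> semialgebraic (S \<inter> T)"

end

theory Submission
  imports Defs
begin

text \<open>
  The combinatorial type of a regular subdivision is finite data. For a point \<open>u\<close>, let the active
  set be the set of indices \<open>i\<close> that maximise \<open>a\<^sub>i + \<langle>s\<^sub>i, u\<rangle>\<close>; it lists the lifted points that lie on
  the upper face with outer normal \<open>(1, u)\<close>. Over each point of an upper face, that face is the
  topmost part of the lifted polytope, so a lifted point whose projection lies in a cell and which is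
  itself on the upper hull already lies on the corresponding face. Hence inclusion of cells is the
  same as inclusion of active sets (\<open>cell_subset_iff\<close>), and the face poset of the subdivision is
  isomorphic to the family of active sets, ordered by inclusion. This family is a set of subsets of a
  finite index type, so only finitely many types occur, and a stratum is a finite union of sets of
  parameters with a prescribed family of active sets.

  Since semialgebraic sets form a Boolean algebra, it remains to treat one index set \<open>J\<close>: the
  parameters for which some point \<open>u\<close> has active set \<open>J\<close>. This says that a finite system of strict
  and weak inequalities is solvable in \<open>u\<close>; the inequalities are affine in \<open>u\<close>, with coefficients
  that are polynomial in the parameter. The unknown \<open>u\<close> is removed one coordinate at a time by
  Fourier--Motzkin elimination, uniformly in the parameter (\<open>semialgebraic_solvable\<close>). Thus
  the full Tarski--Seidenberg theorem is replaced by elementary linear elimination.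
\<close>


section \<open>The Boolean algebra of semialgebraic sets\<close>

lemma semialgebraic_empty: "semialgebraic {}"
  using semialgebraic.strict[OF real_polynomial_function.intros(2)[of 0]] by simp

lemma semialgebraic_UNIV: "semialgebraic UNIV"
  using semialgebraic.weak[OF real_polynomial_function.intros(2)[of 0]] by simp

lemma semialgebraic_Compl:
  assumes "semialgebraic S"
  shows "semialgebraic (- S)"
  using assms
proof induction
  case (strict f)
  have eq: "- {x. 0 < f x} = {x. 0 \<le> - f x}"
    by auto
  show ?case
    unfolding eq by (intro semialgebraic.weak real_polynomial_function_minus strict)
next
  case (weak f)
  have eq: "- {x. 0 \<le> f x} = {x. 0 < - f x}"
    by auto
  show ?case
    unfolding eq by (intro semialgebraic.strict real_polynomial_function_minus weak)
qed (simp_all add: semialgebraic.union semialgebraic.inter)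

lemma semialgebraic_UN:
  assumes "finite A" "\<And>a. a \<in> A \<Longrightarrow> semialgebraic (S a)"
  shows "semialgebraic (\<Union>a\<in>A. S a)"
  using assms by (induction rule: finite_induct) (auto intro: semialgebraic_empty semialgebraic.union)

lemma semialgebraic_INT:
  assumes "finite A" "\<And>a. a \<in> A \<Longrightarrow> semialgebraic (S a)"
  shows "semialgebraic (\<Inter>a\<in>A. S a)"
  using assms by (induction rule: finite_induct) (auto intro: semialgebraic_UNIV semialgebraic.inter)

lemma semialgebraic_zero:
  assumes "real_polynomial_function f"
  shows "semialgebraic {x. f x = 0}"
proof -
  have eq: "{x. f x = 0} = {x. 0 \<le> f x} \<inter> {x. 0 \<le> - f x}"
    by auto
  show ?thesis
    unfolding eq by (intro semialgebraic.inter semialgebraic.weak real_polynomial_function_minus assms)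
qed


section \<open>Fourier--Motzkin elimination of one unknown\<close>

definition satisfies :: "bool \<Rightarrow> real \<Rightarrow> bool" where
  "satisfies strict y \<longleftrightarrow> (if strict then 0 < y else 0 \<le> y)"

lemma satisfies_scale: "0 < a \<Longrightarrow> satisfies b (a * x) \<longleftrightarrow> satisfies b x"
  by (simp add: satisfies_def zero_less_mult_iff zero_le_mult_iff)

lemma satisfies_add: "satisfies b x \<Longrightarrow> satisfies c y \<Longrightarrow> satisfies (b \<or> c) (x + y)"
  by (auto simp: satisfies_def split: if_splits)

text \<open>
  Lower and upper bounds come with a flag for strictness. If both kinds occur, the midpoint between
  the largest lower and the smallest upper bound meets all of them: if these two extreme bounds
  coincide, then no bound with that value can be strict.
\<close>

lemma ex_between_finite_bounds:
  fixes A B :: "(bool \<times> real) set"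
  assumes fin: "finite A" "finite B"
    and le: "\<And>b x c y. (b, x) \<in> A \<Longrightarrow> (c, y) \<in> B \<Longrightarrow> satisfies (b \<or> c) (y - x)"
  shows "\<exists>t. (\<forall>(b, x)\<in>A. satisfies b (t - x)) \<and> (\<forall>(c, y)\<in>B. satisfies c (y - t))"
proof (cases "A = {} \<or> B = {}")
  case True
  show ?thesis
  proof (cases "A = {}")
    case True
    have "satisfies c (y - (Min (snd ` B) - 1))" if "(c, y) \<in> B" for c y
    proof -
      have "Min (snd ` B) \<le> y"
        using that fin by (force intro: Min_le)
      then show ?thesis by (simp add: satisfies_def)
    qed
    with True show ?thesis by auto
  next
    case False
    with \<open>A = {} \<or> B = {}\<close> have B: "B = {}" by simp
    have "satisfies b (Max (snd ` A) + 1 - x)" if "(b, x) \<in> A" for b x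
    proof -
      have "x \<le> Max (snd ` A)"
        using that fin by (force intro: Max_ge)
      then show ?thesis by (simp add: satisfies_def)
    qed
    with B show ?thesis by auto
  qed
next
  case False
  define l where "l = Max (snd ` A)"
  define r where "r = Min (snd ` B)"
  have "l \<in> snd ` A" "r \<in> snd ` B"
    unfolding l_def r_def using False fin by (intro Max_in Min_in; simp)+
  then obtain b0 c0 where extreme: "(b0, l) \<in> A" "(c0, r) \<in> B"
    by force
  have lr: "l \<le> r"
    using le[OF extreme] by (simp add: satisfies_def split: if_splits)
  have "satisfies b ((l + r) / 2 - x)" if "(b, x) \<in> A" for b x
  proof -
    have "x \<le> l"
      unfolding l_def using that fin by (force intro: Max_ge)
    then show ?thesis
      using lr le[OF that extreme(2)] by (auto simp: satisfies_def split: if_splits)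
  qed
  moreover have "satisfies c (y - (l + r) / 2)" if "(c, y) \<in> B" for c y
  proof -
    have "r \<le> y"
      unfolding r_def using that fin by (force intro: Min_le)
    then show ?thesis
      using lr le[OF extreme(1) that] by (auto simp: satisfies_def split: if_splits)
  qed
  ultimately show ?thesis
    by (intro exI[of _ "(l + r) / 2"]) auto
qed

text \<open>
  An inequality with positive coefficient at \<open>t\<close> is a lower bound for \<open>t\<close>, one with negative
  coefficient is an upper bound. Comparing each lower with each upper bound, and clearing the
  denominators so that the result stays polynomial in the coefficients, gives the right-hand side.
\<close>

lemma fourier_motzkin:
  fixes f g :: "'k \<Rightarrow> real"
  assumes "finite K"
  shows "(\<exists>t. \<forall>k\<in>K. satisfies (b k) (f k + g k * t)) \<longleftrightarrow>
    (\<forall>k\<in>K. g k = 0 \<longrightarrow> satisfies (b k) (f k)) \<and>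
    (\<forall>k\<in>K. \<forall>l\<in>K. 0 < g k \<longrightarrow> g l < 0 \<longrightarrow> satisfies (b k \<or> b l) (g k * f l - g l * f k))"
    (is "?lhs \<longleftrightarrow> ?zero \<and> ?pairs")
proof
  assume ?lhs
  then obtain t where t: "\<And>k. k \<in> K \<Longrightarrow> satisfies (b k) (f k + g k * t)"
    by auto
  have ?zero
    using t by (metis add.right_neutral mult_zero_left)
  moreover have "satisfies (b k \<or> b l) (g k * f l - g l * f k)"
    if "k \<in> K" "l \<in> K" "0 < g k" "g l < 0" for k l
  proof -
    \<comment> \<open>The coefficients of \<open>t\<close> cancel.\<close>
    have eq: "g k * f l - g l * f k = (- g l) * (f k + g k * t) + g k * (f l + g l * t)"
      by (simp add: algebra_simps)
    show ?thesis
      unfolding eq using that t by (intro satisfies_add) (subst satisfies_scale; simp)+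
  qed
  ultimately show "?zero \<and> ?pairs" by blast
next
  assume rhs: "?zero \<and> ?pairs"
  define A where "A = (\<lambda>k. (b k, - f k / g k)) ` {k \<in> K. 0 < g k}"
  define B where "B = (\<lambda>k. (b k, - f k / g k)) ` {k \<in> K. g k < 0}"
  have "satisfies (c \<or> c') (y - x)" if xA: "(c, x) \<in> A" and yB: "(c', y) \<in> B" for c x c' y
  proof -
    obtain k where k: "k \<in> K" "0 < g k" "c = b k" "x = - f k / g k"
      using xA by (auto simp: A_def)
    obtain l where l: "l \<in> K" "g l < 0" "c' = b l" "y = - f l / g l"
      using yB by (auto simp: B_def)
    have eq: "y - x = (g k * f l - g l * f k) / (g k * (- g l))"
      using k(2) l(2) by (simp add: k(4) l(4) field_simps)
    have pos: "0 < g k * (- g l)"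
      using k(2) l(2) by (intro mult_pos_pos) auto
    have "satisfies (b k \<or> b l) (g k * f l - g l * f k)"
      using rhs k l by blast
    then show ?thesis
      unfolding eq k(3) l(3) satisfies_def
      using pos divide_pos_pos[OF _ pos] divide_nonneg_pos[OF _ pos] by (auto split: if_splits)
  qed
  then obtain t where lower: "\<forall>(c, x)\<in>A. satisfies c (t - x)"
    and upper: "\<forall>(c, y)\<in>B. satisfies c (y - t)"
    using ex_between_finite_bounds[of A B] assms by (auto simp: A_def B_def)
  have "satisfies (b k) (f k + g k * t)" if "k \<in> K" for k
  proof -
    consider "g k = 0" | "0 < g k" | "g k < 0" by linarith
    then show ?thesis
    proof cases
      case 1
      with rhs that show ?thesis by simp
    next
      case 2
      then have eq: "f k + g k * t = g k * (t - (- f k / g k))"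
        by (simp add: field_simps)
      have "satisfies (b k) (t - (- f k / g k))"
        using lower that 2 by (auto simp: A_def)
      with 2 show ?thesis
        unfolding eq by (subst satisfies_scale) simp_all
    next
      case 3
      then have eq: "f k + g k * t = (- g k) * (- f k / g k - t)"
        by (simp add: field_simps)
      have "satisfies (b k) (- f k / g k - t)"
        using upper that 3 by (auto simp: B_def)
      with 3 show ?thesis
        unfolding eq by (subst satisfies_scale) simp_all
    qed
  qed
  then show ?lhs by blast
qed


section \<open>Solvability of parametric linear systems\<close>

text \<open>
  An inequality that is affine in unknowns indexed by \<open>'e\<close>, with coefficients depending on a parameter.
  The guard is the set of parameters at which the inequality is imposed. Guards absorb the case
  distinction on the signs of the coefficients that elimination needs, so that one system
  serves all parameters at once.
\<close>

datatype ('x, 'e) ineq =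
  Ineq (guard: "'x set") (is_strict: bool) (const: "'x \<Rightarrow> real") (coeff: "'e \<Rightarrow> 'x \<Rightarrow> real")

definition holds :: "'e set \<Rightarrow> ('x, 'e) ineq \<Rightarrow> 'x \<Rightarrow> ('e \<Rightarrow> real) \<Rightarrow> bool" where
  "holds V k x u \<longleftrightarrow>
    (x \<in> guard k \<longrightarrow> satisfies (is_strict k) (const k x + (\<Sum>e\<in>V. coeff k e x * u e)))"

definition polynomial_ineq :: "('x::euclidean_space, 'e) ineq \<Rightarrow> bool" where
  "polynomial_ineq k \<longleftrightarrow> semialgebraic (guard k) \<and> real_polynomial_function (const k) \<and>
    (\<forall>e. real_polynomial_function (coeff k e))"

definition restrict_zero :: "'e \<Rightarrow> ('x, 'e) ineq \<Rightarrow> ('x, 'e) ineq" where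
  "restrict_zero e k = Ineq (guard k \<inter> {x. coeff k e x = 0}) (is_strict k) (const k) (coeff k)"

definition combine :: "'e \<Rightarrow> ('x, 'e) ineq \<Rightarrow> ('x, 'e) ineq \<Rightarrow> ('x, 'e) ineq" where
  "combine e k l = Ineq
    (guard k \<inter> guard l \<inter> {x. 0 < coeff k e x} \<inter> {x. 0 < - coeff l e x})
    (is_strict k \<or> is_strict l)
    (\<lambda>x. coeff k e x * const l x - coeff l e x * const k x)
    (\<lambda>e' x. coeff k e x * coeff l e' x - coeff l e x * coeff k e' x)"

definition eliminate :: "'e \<Rightarrow> ('x, 'e) ineq set \<Rightarrow> ('x, 'e) ineq set" where
  "eliminate e K = restrict_zero e ` K \<union> (\<lambda>(k, l). combine e k l) ` (K \<times> K)"

lemma finite_eliminate: "finite K \<Longrightarrow> finite (eliminate e K)"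
  by (simp add: eliminate_def)

lemma polynomial_ineq_eliminate:
  assumes "\<And>k. k \<in> K \<Longrightarrow> polynomial_ineq k" and "k \<in> eliminate e K"
  shows "polynomial_ineq k"
proof -
  have "polynomial_ineq (restrict_zero e k)" if "polynomial_ineq k" for k
    using that
    by (auto simp: polynomial_ineq_def restrict_zero_def intro: semialgebraic.inter semialgebraic_zero)
  moreover have "polynomial_ineq (combine e k l)" if "polynomial_ineq k" "polynomial_ineq l" for k l
    using that unfolding polynomial_ineq_def combine_def ineq.sel
    by (intro conjI allI semialgebraic.inter semialgebraic.strict real_polynomial_function_diff
        real_polynomial_function_minus real_polynomial_function.intros(4)) auto
  ultimately show ?thesis
    using assms by (auto simp: eliminate_def)
qed

text \<open>
  At a fixed parameter only the inequalities whose guard holds there count. They form an ordinary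
  linear system, in which the unknown \<open>e\<close> plays the role of \<open>t\<close> in \<open>fourier_motzkin\<close>.
\<close>

lemma eliminate_correct:
  assumes "finite K" "finite V" "e \<notin> V"
  shows "(\<exists>u. \<forall>k\<in>K. holds (insert e V) k x u) \<longleftrightarrow> (\<exists>u. \<forall>k\<in>eliminate e K. holds V k x u)"
proof -
  define K' where "K' = {k \<in> K. x \<in> guard k}"
  have K': "finite K'"
    using assms(1) by (simp add: K'_def)
  define F where "F u k = const k x + (\<Sum>e'\<in>V. coeff k e' x * u e')" for u k
  have split: "(\<exists>u. \<forall>k\<in>K. holds (insert e V) k x u) \<longleftrightarrow>
      (\<exists>u t. \<forall>k\<in>K'. satisfies (is_strict k) (F u k + coeff k e x * t))"
  proof
    assume "\<exists>u. \<forall>k\<in>K. holds (insert e V) k x u"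
    then obtain u where "\<forall>k\<in>K. holds (insert e V) k x u" ..
    then have "\<forall>k\<in>K'. satisfies (is_strict k) (F u k + coeff k e x * u e)"
      using assms(2,3) by (auto simp: holds_def K'_def F_def algebra_simps)
    then show "\<exists>u t. \<forall>k\<in>K'. satisfies (is_strict k) (F u k + coeff k e x * t)"
      by blast
  next
    assume "\<exists>u t. \<forall>k\<in>K'. satisfies (is_strict k) (F u k + coeff k e x * t)"
    then obtain u t where ut: "\<forall>k\<in>K'. satisfies (is_strict k) (F u k + coeff k e x * t)"
      by blast
    have "(\<Sum>e'\<in>V. coeff k e' x * (u(e := t)) e') = (\<Sum>e'\<in>V. coeff k e' x * u e')" for k
      using assms(3) by (intro sum.cong) auto
    with ut have "\<forall>k\<in>K. holds (insert e V) k x (u(e := t))"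
      using assms(2,3) by (auto simp: holds_def K'_def F_def algebra_simps)
    then show "\<exists>u. \<forall>k\<in>K. holds (insert e V) k x u"
      by blast
  qed
  have zero: "holds V (restrict_zero e k) x u \<longleftrightarrow>
      (x \<in> guard k \<longrightarrow> coeff k e x = 0 \<longrightarrow> satisfies (is_strict k) (F u k))" for k u
    by (auto simp: holds_def restrict_zero_def F_def)
  have combine: "holds V (combine e k l) x u \<longleftrightarrow>
      (x \<in> guard k \<longrightarrow> x \<in> guard l \<longrightarrow> 0 < coeff k e x \<longrightarrow> coeff l e x < 0 \<longrightarrow>
        satisfies (is_strict k \<or> is_strict l) (coeff k e x * F u l - coeff l e x * F u k))" for k l u
  proof -
    have eq: "coeff k e x * const l x - coeff l e x * const k x +
        (\<Sum>e'\<in>V. (coeff k e x * coeff l e' x - coeff l e x * coeff k e' x) * u e') =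
        coeff k e x * F u l - coeff l e x * F u k"
      by (simp add: F_def sum_distrib_left sum_subtractf algebra_simps)
    show ?thesis
      by (auto simp: holds_def combine_def eq)
  qed
  have "(\<exists>t. \<forall>k\<in>K'. satisfies (is_strict k) (F u k + coeff k e x * t)) \<longleftrightarrow>
      (\<forall>k\<in>eliminate e K. holds V k x u)" for u
    unfolding fourier_motzkin[OF K'] eliminate_def ball_Un
    by (auto simp: zero combine K'_def)
  with split show ?thesis
    by simp
qed

lemma semialgebraic_solvable:
  fixes K :: "('x::euclidean_space, 'e) ineq set"
  assumes "finite V" "finite K" "\<And>k. k \<in> K \<Longrightarrow> polynomial_ineq k"
  shows "semialgebraic {x. \<exists>u. \<forall>k\<in>K. holds V k x u}"
  using assms
proof (induction V arbitrary: K rule: finite_induct)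
  case empty
  have "{x. \<exists>u::'e \<Rightarrow> real. \<forall>k\<in>K. holds {} k x u} =
      (\<Inter>k\<in>K. - guard k \<union> {x. satisfies (is_strict k) (const k x)})"
    by (auto simp: holds_def)
  moreover have "semialgebraic (- guard k \<union> {x. satisfies (is_strict k) (const k x)})"
    if "k \<in> K" for k
    using empty.prems(2)[OF that]
    by (cases "is_strict k") (auto simp: polynomial_ineq_def satisfies_def
        intro!: semialgebraic.union semialgebraic_Compl semialgebraic.strict semialgebraic.weak)
  ultimately show ?case
    using empty.prems(1) by (simp add: semialgebraic_INT)
next
  case (insert e V)
  have "semialgebraic {x. \<exists>u. \<forall>k\<in>eliminate e K. holds V k x u}"
    by (rule insert.IH[OF finite_eliminate[OF insert.prems(1)]
          polynomial_ineq_eliminate[OF insert.prems(2)]])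
  then show ?case
    by (simp add: eliminate_correct[OF insert.prems(1) insert.hyps(1,2)])
qed


section \<open>Cells and active sets\<close>

definition active :: "('i::finite \<Rightarrow> real \<times> 'a::euclidean_space) \<Rightarrow> 'a \<Rightarrow> 'i set" where
  "active p u = {i. \<forall>j. fst (p j) + snd (p j) \<bullet> u \<le> fst (p i) + snd (p i) \<bullet> u}"

definition upper_face ::
    "('i::finite \<Rightarrow> real \<times> 'a::euclidean_space) \<Rightarrow> 'a \<Rightarrow> (real \<times> 'a) set" where
  "upper_face p u = face_in_direction (lifted_polytope p) (1, u)"

lemma upper_faces_eq: "upper_faces p = range (upper_face p)"
proof -
  \<comment> \<open>Rescaling a normal vector to first coordinate \<open>1\<close> does not change its face.\<close>
  have scale: "face_in_direction P (c, u) = face_in_direction P (1, u /\<^sub>R c)" if "0 < c"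
    for P :: "(real \<times> 'a) set" and c u
  proof -
    have "(c, u) \<bullet> y = c * ((1, u /\<^sub>R c) \<bullet> y)" for y
      using that by (cases y) (simp add: algebra_simps)
    with that show ?thesis
      by (simp add: face_in_direction_def)
  qed
  show ?thesis
  proof (intro equalityI subsetI)
    fix F assume "F \<in> upper_faces p"
    then obtain c u where "F = face_in_direction (lifted_polytope p) (c, u)" "0 < c"
      unfolding upper_faces_def by blast
    then have "F = upper_face p (u /\<^sub>R c)"
      unfolding upper_face_def using scale by blast
    then show "F \<in> range (upper_face p)"
      by blast
  next
    fix F assume "F \<in> range (upper_face p)"
    then obtain u where "F = face_in_direction (lifted_polytope p) (1, u)"
      unfolding upper_face_def by blast
    then show "F \<in> upper_faces p"
      unfolding upper_faces_def using zero_less_one by blast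
  qed
qed

lemma mem_upper_face_iff: "p i \<in> upper_face p u \<longleftrightarrow> i \<in> active p u"
proof -
  have "(\<forall>y\<in>convex hull (range p). (1, u) \<bullet> y \<le> c) \<longleftrightarrow> (\<forall>y\<in>range p. (1, u) \<bullet> y \<le> c)" for c
    using subset_hull[of convex "{y. (1, u) \<bullet> y \<le> c}" "range p", OF convex_halfspace_le]
    by (simp only: subset_iff mem_Collect_eq Ball_def)
  then show ?thesis
    by (simp add: upper_face_def face_in_direction_def lifted_polytope_def active_def hull_inc
        inner_prod_def inner_commute)
qed

text \<open>A face of a convex hull is spanned by the generators that it contains.\<close>

lemma upper_face_eq_hull: "upper_face p u = convex hull (p ` active p u)"
proof -
  let ?F = "upper_face p u"
  have "?F face_of convex hull (range p)"
    by (simp add: upper_face_def lifted_polytope_def face_in_direction_face_of)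
  then obtain S where S: "S \<subseteq> range p" "?F = convex hull S"
    using face_of_convex_hull_subset[of "range p"] by (auto simp: finite_imp_compact)
  have "S \<subseteq> p ` active p u"
  proof
    fix y assume y: "y \<in> S"
    then obtain i where "y = p i" using S(1) by blast
    moreover have "y \<in> ?F" using y by (simp add: S(2) hull_inc)
    ultimately show "y \<in> p ` active p u" by (simp add: mem_upper_face_iff)
  qed
  then have "?F \<subseteq> convex hull (p ` active p u)"
    unfolding S(2) by (rule hull_mono)
  moreover have "convex ?F"
    unfolding S(2) by (rule convex_convex_hull)
  then have "convex hull (p ` active p u) \<subseteq> ?F"
    by (intro hull_minimal) (auto simp: mem_upper_face_iff)
  ultimately show ?thesis by blast
qed

text \<open>
  For the nontrivial direction let \<open>i\<close> be active at \<open>u\<close>. The face at \<open>v\<close> contains a point with the same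
  projection as \<open>p i\<close>. A normal vector with first coordinate \<open>1\<close> prefers the higher of two points with
  the same projection, so both points have the maximal height there and coincide.
\<close>

lemma cell_subset_iff:
  "snd ` upper_face p u \<subseteq> snd ` upper_face p v \<longleftrightarrow> active p u \<subseteq> active p v"
proof
  assume "active p u \<subseteq> active p v"
  then show "snd ` upper_face p u \<subseteq> snd ` upper_face p v"
    by (simp add: upper_face_eq_hull hull_mono image_mono)
next
  assume sub: "snd ` upper_face p u \<subseteq> snd ` upper_face p v"
  show "active p u \<subseteq> active p v"
  proof
    fix i assume "i \<in> active p u"
    then have i: "p i \<in> upper_face p u"
      by (simp add: mem_upper_face_iff)
    then have "snd (p i) \<in> snd ` upper_face p v"
      using sub by blast
    then obtain y where y: "y \<in> upper_face p v" "snd y = snd (p i)"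
      by force
    have "(1, v) \<bullet> p i \<le> (1, v) \<bullet> y" and "(1, u) \<bullet> y \<le> (1, u) \<bullet> p i"
      using i y(1) by (auto simp: upper_face_def face_in_direction_def)
    then have "fst y = fst (p i)"
      using y(2) by (simp add: inner_prod_def)
    then have "y = p i"
      using y(2) by (simp add: prod_eq_iff)
    with y(1) show "i \<in> active p v"
      by (simp add: mem_upper_face_iff)
  qed
qed

lemma face_poset_iso_range:
  assumes "\<And>u v. f u \<subseteq> f v \<longleftrightarrow> g u \<subseteq> g v"
  shows "face_poset_iso (range f) (range g)"
proof -
  have eq: "f u = f v \<longleftrightarrow> g u = g v" for u v
    using assms[of u v] assms[of v u] by blast
  define h where "h A = g (SOME u. f u = A)" for A
  have h: "h (f u) = g u" for u
    unfolding h_def using someI[of "\<lambda>w. f w = f u" u] eq by blast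
  have "bij_betw h (range f) (range g)"
    by (auto simp: bij_betw_def inj_on_def h eq image_image)
  then show ?thesis
    unfolding face_poset_iso_def by (intro exI[of _ h]) (auto simp: h assms)
qed

lemma face_poset_iso_active: "face_poset_iso (regular_subdivision p) (range (active p))"
  using face_poset_iso_range[of "\<lambda>u. snd ` upper_face p u" "active p"]
  by (simp add: regular_subdivision_def upper_faces_eq image_image cell_subset_iff)

text \<open>
  The family of active sets determines the combinatorial type. Different families can be isomorphic
  as posets, for instance after a permutation of the indices; therefore a stratum is in general a
  union over several families.
\<close>

lemma combinatorial_type_eqI:
  assumes "range (active p) = range (active q)"
  shows "combinatorial_type (regular_subdivision p) = combinatorial_type (regular_subdivision q)"
  unfolding combinatorial_type_eq_iff
  using face_poset_iso_trans[OF face_poset_iso_active[of p, unfolded assms]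
      face_poset_iso_sym[OF face_poset_iso_active[of q]]] .

lemma finite_subdivision_types:
  "finite (subdivision_types TYPE('i::finite) :: 'a::euclidean_space set set set set)"
proof -
  let ?type = "\<lambda>p :: 'i \<Rightarrow> real \<times> 'a. combinatorial_type (regular_subdivision p)"
  let ?rep = "\<lambda>M. ?type (SOME p. range (active p) = M)"
  have "?type p = ?rep (range (active p))" for p
    by (intro combinatorial_type_eqI) (rule sym, rule someI[of "\<lambda>q. range (active q) = range (active p)"], rule refl)
  then have "range ?type \<subseteq> range ?rep"
    by blast
  then show ?thesis
    unfolding subdivision_types_def by (rule finite_subset) simp
qed


section \<open>Semialgebraicity in the parameter\<close>

text \<open>
  The inequalities express that \<open>J\<close> is active at \<open>u\<close>: terms in \<open>J\<close> dominate all terms, strictly so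
  those outside \<open>J\<close>. For empty \<open>J\<close> they would impose nothing, although active sets are never empty.
\<close>

lemma semialgebraic_active:
  fixes p :: "'x::euclidean_space \<Rightarrow> 'i::finite \<Rightarrow> real \<times> 'a::euclidean_space"
  assumes height: "\<And>i. real_polynomial_function (\<lambda>x. fst (p x i))"
    and point: "\<And>i e. real_polynomial_function (\<lambda>x. snd (p x i) \<bullet> e)"
  shows "semialgebraic {x. J \<in> range (active (p x))}"
proof (cases "J = {}")
  case True
  have "active (p x) u \<noteq> {}" for x u
  proof -
    let ?h = "\<lambda>i. fst (p x i) + snd (p x i) \<bullet> u"
    have "Max (range ?h) \<in> range ?h"
      by (intro Max_in) auto
    then obtain i where "?h i = Max (range ?h)"
      by force
    then have "i \<in> active (p x) u"
      by (simp add: active_def)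
    then show ?thesis by blast
  qed
  then have "{x. J \<in> range (active (p x))} = {}"
    using True by force
  then show ?thesis
    by (simp only: semialgebraic_empty)
next
  case False
  define ineq where "ineq i j = Ineq UNIV (j \<notin> J)
      (\<lambda>x. fst (p x i) - fst (p x j)) (\<lambda>e x. snd (p x i) \<bullet> e - snd (p x j) \<bullet> e)" for i j
  define K where "K = (\<lambda>(i, j). ineq i j) ` (J \<times> UNIV)"
  have active_iff: "J = active (p x) u \<longleftrightarrow> (\<forall>k\<in>K. holds Basis k x (\<lambda>e. u \<bullet> e))" for x u
  proof -
    have "holds Basis (ineq i j) x (\<lambda>e. u \<bullet> e) \<longleftrightarrow>
        satisfies (j \<notin> J) ((fst (p x i) + snd (p x i) \<bullet> u) - (fst (p x j) + snd (p x j) \<bullet> u))" for i j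
      by (simp add: holds_def ineq_def left_diff_distrib sum_subtractf
          euclidean_inner[of "snd (p x _)" u] algebra_simps)
    then have "(\<forall>k\<in>K. holds Basis k x (\<lambda>e. u \<bullet> e)) \<longleftrightarrow> (\<forall>i\<in>J. \<forall>j.
        satisfies (j \<notin> J) ((fst (p x i) + snd (p x i) \<bullet> u) - (fst (p x j) + snd (p x j) \<bullet> u)))"
      by (simp add: K_def)
    also have "\<dots> \<longleftrightarrow> J = active (p x) u"
    proof
      assume dominates: "\<forall>i\<in>J. \<forall>j.
        satisfies (j \<notin> J) ((fst (p x i) + snd (p x i) \<bullet> u) - (fst (p x j) + snd (p x j) \<bullet> u))"
      obtain i0 where "i0 \<in> J" using False by blast
      show "J = active (p x) u"
      proof (intro set_eqI iffI)
        fix i assume "i \<in> J"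
        with dominates show "i \<in> active (p x) u"
          by (force simp: active_def satisfies_def split: if_splits)
      next
        fix i assume i: "i \<in> active (p x) u"
        show "i \<in> J"
        proof (rule ccontr)
          assume "i \<notin> J"
          moreover have "fst (p x i0) + snd (p x i0) \<bullet> u \<le> fst (p x i) + snd (p x i) \<bullet> u"
            using i by (simp add: active_def)
          ultimately show False
            using dominates[rule_format, OF \<open>i0 \<in> J\<close>, of i] by (simp add: satisfies_def)
        qed
      qed
    next
      assume "J = active (p x) u"
      then show "\<forall>i\<in>J. \<forall>j.
        satisfies (j \<notin> J) ((fst (p x i) + snd (p x i) \<bullet> u) - (fst (p x j) + snd (p x j) \<bullet> u))"
        by (force simp: active_def satisfies_def not_le intro: less_le_trans)
    qed
    finally show ?thesis by simp
  qed
  have "(\<exists>u. \<forall>k\<in>K. holds Basis k x (\<lambda>e. u \<bullet> e)) \<longleftrightarrow> (\<exists>w. \<forall>k\<in>K. holds Basis k x w)" for x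
  proof
    assume "\<exists>w. \<forall>k\<in>K. holds Basis k x w"
    then obtain w where "\<forall>k\<in>K. holds Basis k x w" ..
    then have "\<forall>k\<in>K. holds Basis k x (\<lambda>e. (\<Sum>e\<in>Basis. w e *\<^sub>R e) \<bullet> e)"
      by (simp add: holds_def cong: sum.cong)
    then show "\<exists>u. \<forall>k\<in>K. holds Basis k x (\<lambda>e. u \<bullet> e)"
      by blast
  qed blast
  then have "{x. J \<in> range (active (p x))} = {x. \<exists>w. \<forall>k\<in>K. holds Basis k x w}"
    by (simp add: image_iff active_iff)
  moreover have "semialgebraic {x. \<exists>w. \<forall>k\<in>K. holds Basis k x w}"
  proof (rule semialgebraic_solvable)
    show "polynomial_ineq k" if "k \<in> K" for k
      using that
      by (auto simp: K_def ineq_def polynomial_ineq_def semialgebraic_UNIV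
          intro!: real_polynomial_function_diff height point)
  qed (simp_all add: K_def)
  ultimately show ?thesis by simp
qed

lemma semialgebraic_combinatorial_type:
  fixes p :: "'x::euclidean_space \<Rightarrow> 'i::finite \<Rightarrow> real \<times> 'a::euclidean_space"
  assumes "\<And>i. real_polynomial_function (\<lambda>x. fst (p x i))"
    and "\<And>i e. real_polynomial_function (\<lambda>x. snd (p x i) \<bullet> e)"
  shows "semialgebraic {x. combinatorial_type (regular_subdivision (p x)) = \<tau>}"
proof -
  let ?S = "{x. combinatorial_type (regular_subdivision (p x)) = \<tau>}"
  define act where "act x = range (active (p x))" for x
  have act: "semialgebraic {x. J \<in> act x}" for J
    unfolding act_def by (rule semialgebraic_active[OF assms])
  have "semialgebraic {x. act x = M}" for M
  proof -
    have eq: "{x. act x = M} = (\<Inter>J. if J \<in> M then {x. J \<in> act x} else - {x. J \<in> act x})"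
      by (auto split: if_splits)
    show ?thesis
      unfolding eq using act
      by (intro semialgebraic_INT) (simp_all only: finite semialgebraic_Compl split: if_split, simp)
  qed
  then have "semialgebraic (\<Union>M\<in>act ` ?S. {x. act x = M})"
    by (intro semialgebraic_UN) auto
  also have "(\<Union>M\<in>act ` ?S. {x. act x = M}) = ?S"
    using combinatorial_type_eqI by (auto simp: act_def)
  finally show ?thesis .
qed

lemma real_polynomial_function_joint_terms:
  fixes e :: "real^'d"
  shows "real_polynomial_function (\<lambda>\<theta> :: ('d::finite, 'n::finite, 'm::finite) param. fst (joint_terms \<theta> k))"
    and "real_polynomial_function (\<lambda>\<theta> :: ('d, 'n, 'm) param. snd (joint_terms \<theta> k) \<bullet> e)"
proof -
  have "linear (\<lambda>\<theta> :: ('d, 'n, 'm) param. fst (joint_terms \<theta> k))"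
    by (cases k; intro linearI; simp add: joint_terms_def)
  then show "real_polynomial_function (\<lambda>\<theta> :: ('d, 'n, 'm) param. fst (joint_terms \<theta> k))"
    by (intro real_polynomial_function.intros(1)) (simp only: linear_conv_bounded_linear)
  have "linear (\<lambda>\<theta> :: ('d, 'n, 'm) param. snd (joint_terms \<theta> k) \<bullet> e)"
    by (cases k; intro linearI; simp add: joint_terms_def inner_add_left)
  then show "real_polynomial_function (\<lambda>\<theta> :: ('d, 'n, 'm) param. snd (joint_terms \<theta> k) \<bullet> e)"
    by (intro real_polynomial_function.intros(1)) (simp only: linear_conv_bounded_linear)
qed

theorem theorem4p4:
  shows "finite (subdivision_types TYPE('n::finite + 'm::finite) :: (real^'d::finite) set set set set)
    \<and> (\<forall>\<tau> \<in> subdivision_types TYPE('n + 'm).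
         semialgebraic (stratum \<tau> :: ('d, 'n, 'm) param set))
    \<and> disjoint_family_on (stratum :: (real^'d) set set set \<Rightarrow> ('d, 'n, 'm) param set)
         (subdivision_types TYPE('n + 'm))
    \<and> (\<Union>\<tau> \<in> subdivision_types TYPE('n + 'm). stratum \<tau>) = (UNIV :: ('d, 'n, 'm) param set)"
proof (intro conjI ballI)
  show "finite (subdivision_types TYPE('n + 'm) :: (real^'d) set set set set)"
    by (rule finite_subdivision_types)
  show "semialgebraic (stratum \<tau> :: ('d, 'n, 'm) param set)" for \<tau>
    unfolding stratum_def induced_subdivision_def
    by (intro semialgebraic_combinatorial_type real_polynomial_function_joint_terms)
  show "disjoint_family_on (stratum :: (real^'d) set set set \<Rightarrow> ('d, 'n, 'm) param set)
      (subdivision_types TYPE('n + 'm))"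
    by (auto simp: disjoint_family_on_def stratum_def)
  show "(\<Union>\<tau> \<in> subdivision_types TYPE('n + 'm). stratum \<tau>) = (UNIV :: ('d, 'n, 'm) param set)"
    by (auto simp: stratum_def subdivision_types_def induced_subdivision_def)
qed

end
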